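(* Let $n,k$ be integers with $3\le k\le n-1$. Then $\frac1k<\frac{n-k+1}{2n-k}$. Let $r,m$ be positive integers such that $q=\frac rm$ satisfies $\frac1k<q<\frac{n-k+1}{2n-k}$, and define for $x\in\mathbb{R}^n$ \[L_k(x)=\frac{x_1+\dots+x_{n-k+1}}{n-k+1},\qquad L(x)=\frac{1}{1-q}\left(\frac{x_1+\dots+x_n}{n}-qL_k(x)\right),\qquad p(x)=L_k(x)^rL(x)^{m-r}.\] Then $p$ is a $\boldsymbol{1}$-central hyperbolic polynomial of degree $m$ on $\mathbb{R}^n$ whose Gårding cone satisfies $\Gamma(p)_+\supset\Gamma(n,k)_+$, but $\sigma_k$ majorization fails for $p$: for all sufficiently small $\varepsilon>0$, the point $x_\varepsilon=(\varepsilon,\dots,\varepsilon,1,\dots,1)$ (with $n-k+1$ coordinates equal to $\varepsilon$ followed by $k-1$ coordinates equal to $1$) lies in $\Gamma(n,k)_+$ and \[p(x_\varepsilon)^{\frac1m}<p(\boldsymbol{1})^{\frac1m}\left(\frac{\sigma_k(x_\varepsilon)}{\binom nk}\right)^{\frac1k}.\]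
   Context: $\boldsymbol{1}=(1,\dots,1)\in\mathbb{R}^n$, and $\sigma_k(x)=\sum_{i_1<\dots<i_k}x_{i_1}\cdots x_{i_k}$. A homogeneous polynomial $p$ of degree $m$ (with $m \ge 1$) on a finite-dimensional real vector space $V$ is hyperbolic with respect to $a\in V$ ($a$-hyperbolic) if $p(a)>0$ and for every $x\in V$ the polynomial $s\mapsto p(sa+x)$ has only real roots; then $p(sa+x)=p(a)\prod_{j=1}^m(s+\lambda_j^{p,a}(x))$ with real $\lambda_j^{p,a}(x)$. Its Gårding cone is $\Gamma(p)_+=\{x:\lambda^{p,a}_j(x)>0\ \forall j\}$, equivalently the connected component of $\{p>0\}$ containing $a$. Set $\operatorname{tr}^{p,a}(x)=\sum_{j=1}^m\lambda_j^{p,a}(x)$. A $\boldsymbol{1}$-hyperbolic polynomial $p$ of degree $m$ on $\mathbb{R}^n$ is $\boldsymbol{1}$-central if there is a constant $\kappa>0$ with $\operatorname{tr}^{p,\boldsymbol{1}}(x)=\kappa(x_1+\dots+x_n)$ for all $x\in\mathbb{R}^n$ (necessarily $\kappa=m/n$). Gårding cones on $\mathbb{R}^n$ here are taken with respect to $\boldsymbol{1}$. The polynomial $\sigma_k$ is $\boldsymbol{1}$-hyperbolic, and $\Gamma(n,k)_+$ denotes its Gårding cone with respect to $\boldsymbol{1}$ (the connected component of $\{\sigma_k>0\}$ containing $\boldsymbol{1}$). *)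

theory Defs
  imports "HOL-Analysis.Analysis" "HOL-Computational_Algebra.Computational_Algebra"
begin

definition homogeneous_polynomial :: "nat \<Rightarrow> ('a::euclidean_space \<Rightarrow> real) \<Rightarrow> bool" where
  "homogeneous_polynomial m p \<longleftrightarrow>
     real_polynomial_function p \<and> (\<forall>c x. p (c *\<^sub>R x) = c ^ m * p x)"

text \<open>The univariate polynomial \<open>s \<mapsto> p (s a + x)\<close> as an element of \<^typ>\<open>real poly\<close>;
  for polynomial functions \<open>p\<close> it exists and is unique (lemma \<open>poly_line_poly\<close> below).\<close>

definition line_poly :: "('a::euclidean_space \<Rightarrow> real) \<Rightarrow> 'a \<Rightarrow> 'a \<Rightarrow> real poly" where
  "line_poly p a x = (THE q. \<forall>s. poly q s = p (s *\<^sub>R a + x))"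

definition hyperbolic :: "nat \<Rightarrow> ('a::euclidean_space \<Rightarrow> real) \<Rightarrow> 'a \<Rightarrow> bool" where
  "hyperbolic m p a \<longleftrightarrow>
     m \<ge> 1 \<and> homogeneous_polynomial m p \<and> p a > 0 \<and>
     (\<forall>x. \<forall>z::complex. poly (map_poly of_real (line_poly p a x)) z = 0 \<longrightarrow> z \<in> \<real>)"

text \<open>The multiset of the \<open>\<lambda>\<^sub>j\<close>, i.e. the negated roots with multiplicity.  For hyperbolic
  \<open>p\<close> they are exactly the numbers with \<open>p (s a + x) = p a * (\<Prod>j. s + \<lambda>\<^sub>j)\<close>; see
  lemma \<open>hyperbolic_factorization\<close>.\<close>

definition hyp_eigenvalues :: "('a::euclidean_space \<Rightarrow> real) \<Rightarrow> 'a \<Rightarrow> 'a \<Rightarrow> real multiset" where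
  "hyp_eigenvalues p a x = image_mset uminus (proots (line_poly p a x))"

definition garding_cone :: "('a::euclidean_space \<Rightarrow> real) \<Rightarrow> 'a \<Rightarrow> 'a set" where
  "garding_cone p a = {x. \<forall>l \<in># hyp_eigenvalues p a x. l > 0}"

definition hyp_trace :: "('a::euclidean_space \<Rightarrow> real) \<Rightarrow> 'a \<Rightarrow> 'a \<Rightarrow> real" where
  "hyp_trace p a x = sum_mset (hyp_eigenvalues p a x)"

text \<open>On \<^typ>\<open>real ^ 'n\<close> the constant \<open>1\<close> is the all-ones vector.\<close>

definition one_central :: "nat \<Rightarrow> (real ^ 'n \<Rightarrow> real) \<Rightarrow> bool" where
  "one_central m p \<longleftrightarrow>
     hyperbolic m p 1 \<and>
     (\<exists>\<kappa>>0. \<forall>x. hyp_trace p 1 x = \<kappa> * (\<Sum>i\<in>UNIV. x $ i))"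

definition esym :: "nat \<Rightarrow> real ^ 'n \<Rightarrow> real" where
  "esym k x = (\<Sum>S | S \<subseteq> (UNIV :: 'n set) \<and> card S = k. \<Prod>i\<in>S. x $ i)"

text \<open>In the following definitions \<open>e\<close> is an enumeration \<open>{1..n} \<rightarrow> 'n\<close> of the coordinates,
  so that \<open>x $ e i\<close> is the \<open>i\<close>-th coordinate of \<open>x\<close>.\<close>

definition head_mean :: "(nat \<Rightarrow> 'n) \<Rightarrow> nat \<Rightarrow> nat \<Rightarrow> real ^ 'n \<Rightarrow> real" where
  "head_mean e n k x = (\<Sum>i=1..n-k+1. x $ e i) / real (n - k + 1)"

definition compl_mean :: "(nat \<Rightarrow> 'n) \<Rightarrow> nat \<Rightarrow> nat \<Rightarrow> real \<Rightarrow> real ^ 'n \<Rightarrow> real" where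
  "compl_mean e n k q x =
     1 / (1 - q) * ((\<Sum>i=1..n. x $ e i) / real n - q * head_mean e n k x)"

definition mean_product :: "(nat \<Rightarrow> 'n) \<Rightarrow> nat \<Rightarrow> nat \<Rightarrow> nat \<Rightarrow> nat \<Rightarrow> real ^ 'n \<Rightarrow> real" where
  "mean_product e n k r m x =
     head_mean e n k x ^ r * compl_mean e n k (real r / real m) x ^ (m - r)"

definition head_eps :: "(nat \<Rightarrow> 'n) \<Rightarrow> nat \<Rightarrow> nat \<Rightarrow> real \<Rightarrow> real ^ 'n" where
  "head_eps e n k \<epsilon> = (\<chi> j. if j \<in> e ` {1..n-k+1} then \<epsilon> else 1)"


lemma real_polynomial_function_line:
  fixes p :: "'a::euclidean_space \<Rightarrow> real"
  assumes "real_polynomial_function p"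
  shows "\<exists>q. \<forall>s. poly q s = p (s *\<^sub>R a + x)"
  using assms
proof induction
  case (linear f)
  interpret bounded_linear f by fact
  have "\<forall>s. poly [:f x, f a:] s = f (s *\<^sub>R a + x)"
    by (simp add: add scaleR)
  then show ?case by blast
next
  case (const c)
  have "\<forall>s. poly [:c:] s = c" by simp
  then show ?case by blast
next
  case (add f g)
  then show ?case by (metis poly_add)
next
  case (mult f g)
  then show ?case by (metis poly_mult)
qed

lemma poly_line_poly:
  fixes p :: "'a::euclidean_space \<Rightarrow> real"
  assumes "real_polynomial_function p"
  shows "poly (line_poly p a x) s = p (s *\<^sub>R a + x)"
proof -
  have "\<exists>!q. \<forall>s. poly q s = p (s *\<^sub>R a + x)"
    using real_polynomial_function_line[OF assms, of a x]
    by (metis poly_eq_poly_eq_iff ext)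
  from theI'[OF this] show ?thesis by (simp add: line_poly_def)
qed

lemma real_rooted_factorization:
  fixes q :: "real poly"
  assumes "q \<noteq> 0"
    and "\<And>z::complex. poly (map_poly of_real q) z = 0 \<Longrightarrow> z \<in> \<real>"
  shows "q = smult (lead_coeff q) (\<Prod>r\<in>#proots q. [:- r, 1:]) \<and> size (proots q) = degree q"
  using assms
proof (induction "degree q" arbitrary: q)
  case 0
  then obtain c where "q = [:c:]" by (metis degree_eq_zeroE)
  then show ?case by simp
next
  case (Suc d)
  have dm: "degree (map_poly of_real q :: complex poly) = degree q"
    by (simp add: degree_map_poly)
  then obtain z :: complex where z: "poly (map_poly of_real q) z = 0"
    using Suc.hyps(2) by (metis alg_closed_imp_poly_has_root zero_less_Suc)
  then obtain r where r: "z = of_real r" using Suc.prems(2) Reals_cases by blast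
  have "poly q r = 0" using z
    by (simp add: r poly_altdef coeff_map_poly degree_map_poly flip: of_real_mult of_real_power of_real_sum)
  then obtain q' where q': "q = [:- r, 1:] * q'" by (metis dvdE poly_eq_0_iff_dvd)
  then have nz: "q' \<noteq> 0" using Suc.prems by auto
  have deg: "degree q = Suc (degree q')" unfolding q' using nz by (subst degree_mult_eq) auto
  have m: "(map_poly of_real q :: complex poly) = [:- of_real r, 1:] * map_poly of_real q'"
    unfolding q' by (rule poly_eqI) (auto simp: coeff_map_poly coeff_pCons split: nat.splits)
  have IH: "q' = smult (lead_coeff q') (\<Prod>r\<in>#proots q'. [:- r, 1:]) \<and>
      size (proots q') = degree q'"
    using Suc.hyps deg nz Suc.prems(2) by (intro Suc.hyps(1)) (auto simp: m)
  have pr: "proots q = add_mset r (proots q')"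
    unfolding q' using nz by (subst proots_mult) auto
  have lc: "lead_coeff q = lead_coeff q'" unfolding q' by (subst lead_coeff_mult) auto
  have "q = [:- r, 1:] * smult (lead_coeff q') (\<Prod>r\<in>#proots q'. [:- r, 1:])"
    using IH q' by metis
  also have "\<dots> = smult (lead_coeff q') (\<Prod>r\<in>#proots q. [:- r, 1:])"
    by (simp only: pr image_mset_add_mset prod_mset.add_mset mult_smult_right)
  finally have "q = smult (lead_coeff q) (\<Prod>r\<in>#proots q. [:- r, 1:])"
    by (simp only: lc)
  moreover have "size (proots q) = degree q" using IH by (simp only: pr deg size_add_mset)
  ultimately show ?case by blast
qed

lemma line_poly_lead:
  fixes p :: "'a::euclidean_space \<Rightarrow> real"
  assumes hom: "homogeneous_polynomial m p" and pa: "p a \<noteq> 0"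
  shows "degree (line_poly p a x) = m" "lead_coeff (line_poly p a x) = p a"
proof -
  have rp: "real_polynomial_function p" using hom by (simp add: homogeneous_polynomial_def)
  define q where "q = line_poly p a x"
  define t where "t = line_poly p x a"
  have t0: "coeff t 0 = p a"
    using poly_line_poly[OF rp, of x a 0] by (simp add: t_def poly_0_coeff_0)
  have tnz: "t \<noteq> 0" using t0 pa by auto
  have "poly (q * monom 1 (degree t)) s = poly (monom 1 m * reflect_poly t) s"
    if "s \<noteq> 0" for s
  proof -
    have "p (s *\<^sub>R a + x) = p (s *\<^sub>R (inverse s *\<^sub>R x + a))"
      using that by (simp add: algebra_simps)
    also have "\<dots> = s ^ m * poly t (inverse s)"
      using hom unfolding homogeneous_polynomial_def t_def poly_line_poly[OF rp] by metis
    finally show ?thesis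
      using that
      by (simp add: q_def poly_line_poly[OF rp] poly_monom poly_reflect_poly_nz)
  qed
  then have inf: "- {0} \<subseteq> {s. poly (q * monom 1 (degree t) - monom 1 m * reflect_poly t) s = 0}"
    by auto
  have "infinite (- {0::real})"
    using infinite_UNIV_char_0 by (simp add: Compl_eq_Diff_UNIV)
  then have eq: "q * monom 1 (degree t) = monom 1 m * reflect_poly t"
    using inf poly_roots_finite finite_subset right_minus_eq by metis
  have rnz: "reflect_poly t \<noteq> 0" using tnz by simp
  have qnz: "q \<noteq> 0" using eq rnz by auto
  have "degree q + degree t = m + degree t"
    using arg_cong[OF eq, of degree] qnz rnz t0 pa
    by (simp add: degree_mult_eq degree_monom_eq)
  then show "degree (line_poly p a x) = m" by (simp add: q_def)
  have "lead_coeff q = lead_coeff (reflect_poly t)"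
    using arg_cong[OF eq, of lead_coeff]
    by (simp only: lead_coeff_mult lead_coeff_monom mult_1_left mult_1_right)
  also have "\<dots> = p a" using t0 pa by (simp add: coeff_reflect_poly)
  finally show "lead_coeff (line_poly p a x) = p a" by (simp add: q_def)
qed

lemma hyperbolic_factorization:
  fixes p :: "'a::euclidean_space \<Rightarrow> real"
  assumes "hyperbolic m p a"
  shows "size (hyp_eigenvalues p a x) = m"
    and "p (s *\<^sub>R a + x) = p a * (\<Prod>l\<in>#hyp_eigenvalues p a x. s + l)"
proof -
  have hom: "homogeneous_polynomial m p" and rp: "real_polynomial_function p"
    and pa: "p a \<noteq> 0" and m: "m \<ge> 1"
    and rr: "\<And>z::complex. poly (map_poly of_real (line_poly p a x)) z = 0 \<Longrightarrow> z \<in> \<real>"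
    using assms by (auto simp: hyperbolic_def homogeneous_polynomial_def)
  have nz: "line_poly p a x \<noteq> 0" using line_poly_lead(1)[OF hom pa, of x] m by auto
  note fac = real_rooted_factorization[OF nz rr]
  show "size (hyp_eigenvalues p a x) = m"
    using fac line_poly_lead(1)[OF hom pa, of x] by (simp add: hyp_eigenvalues_def)
  have ev: "poly (\<Prod>r\<in>#M. [:- r, 1:]) s = (\<Prod>l\<in>#image_mset uminus M. s + l)"
    for M :: "real multiset" by (induction M) (auto simp: algebra_simps)
  have "line_poly p a x = smult (p a) (\<Prod>r\<in>#proots (line_poly p a x). [:- r, 1:])"
    using fac line_poly_lead(2)[OF hom pa, of x] by simp
  from arg_cong[OF this, of "\<lambda>q. poly q s"]
  show "p (s *\<^sub>R a + x) = p a * (\<Prod>l\<in>#hyp_eigenvalues p a x. s + l)"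
    by (simp only: poly_line_poly[OF rp] poly_smult ev hyp_eigenvalues_def)
qed

end

theory Submission
  imports Defs
begin

text \<open>
  With \<open>f(t) = \<Prod>i. (t + x\<^sub>i)\<close> one has \<open>\<sigma>\<^sub>k(t 1 + x) = f\<^sup>(\<^sup>n\<^sup>-\<^sup>k\<^sup>)(t) / (n-k)!\<close>, so \<open>x \<in> \<Gamma>(n,k)\<^sub>+\<close> means
  that all roots of the \<open>(n-k)\<close>-th derivative of \<open>f\<close> are negative. The cone inclusion amounts to
  \<open>L\<^sub>k(x) > 0\<close> and \<open>L(x) > 0\<close> on \<open>\<Gamma>(n,k)\<^sub>+\<close>, two statements about the roots \<open>-x\<^sub>i\<close> of \<open>f\<close>. Removing a root
  from \<open>f\<close> does not move the largest root of a derivative to the right; keeping only the \<open>n-k+1\<close>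
  head roots makes the derivative linear and gives \<open>L\<^sub>k(x) > 0\<close>. For \<open>L\<close> it suffices that
  \<open>n B + (n-k) (A+B) \<ge> 0\<close>, where \<open>A\<close> and \<open>B\<close> are the sums of the head and tail coordinates. If \<open>n-k > k-2\<close>, taking
  \<open>k-2\<close> derivatives produces a root at least the mean of the tail roots, and the other \<open>n-2k+2\<close>
  derivatives contract the distance from the largest root to the mean of all roots by a factor no
  smaller than \<open>(k-1)/(n-k+1)\<close>. The failure of majorization is a comparison of exponents of
  \<open>\<epsilon>\<close>: \<open>p(x\<^sub>\<epsilon>)\<^sup>1\<^sup>/\<^sup>m\<close> is of order \<open>\<epsilon>\<^sup>q\<close>, whereas \<open>\<sigma>\<^sub>k(x\<^sub>\<epsilon>)\<^sup>1\<^sup>/\<^sup>k\<close> is of order \<open>\<epsilon>\<^sup>1\<^sup>/\<^sup>k\<close> and \<open>q > 1/k\<close>.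
\<close>

no_notation fps_nth (infixl \<open>$\<close> 75)

section \<open>Derivatives of real-rooted polynomials\<close>

abbreviation roots_poly :: "'a::field_char_0 multiset \<Rightarrow> 'a poly" where
  "roots_poly M \<equiv> \<Prod>a\<in>#M. [:- a, 1:]"

lemma poly_roots_poly: "poly (roots_poly M) t = (\<Prod>a\<in>#M. t - a)"
  by (induction M) (auto simp: algebra_simps)

lemma roots_poly_nz [simp]: "roots_poly M \<noteq> 0"
  by (induction M) (auto simp del: mult_pCons_left)

lemma poly_roots_poly_eq_0 [simp]: "poly (roots_poly M) t = 0 \<longleftrightarrow> t \<in># M"
  by (induction M) auto

lemma degree_roots_poly [simp]: "degree (roots_poly M) = size M"
proof (induction M)
  case (add a M)
  then show ?case by (simp del: mult_pCons_left) (subst degree_mult_eq, auto)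
qed simp

lemma lead_coeff_roots_poly: "lead_coeff (roots_poly M) = 1"
  by (induction M) (simp_all only: lead_coeff_mult image_mset_add_mset prod_mset.add_mset image_mset_empty prod_mset_empty, simp_all)

lemma map_poly_roots_poly:
  "map_poly (of_real :: real \<Rightarrow> complex) (roots_poly M) = roots_poly (image_mset of_real M)"
proof (induction M)
  case (add a M)
  have "map_poly (of_real :: real \<Rightarrow> complex) ([:- a, 1:] * q) = [:- of_real a, 1:] * map_poly of_real q" for q
    by (rule poly_eqI) (auto simp: coeff_map_poly coeff_pCons split: nat.splits)
  with add show ?case by (simp only: image_mset_add_mset prod_mset.add_mset)
qed simp

lemma pderiv_roots_poly_log_deriv:
  assumes "t \<notin># M"
  shows "poly (pderiv (roots_poly M)) t = poly (roots_poly M) t * (\<Sum>a\<in>#M. 1 / (t - a))"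
  using assms
proof (induction M)
  case (add a M)
  then show ?case
    by (simp add: pderiv_mult pderiv_pCons field_simps del: mult_pCons_left)
qed simp

text \<open>The imaginary part of \<open>\<Sum>a. 1 / (z - a)\<close> has the sign opposite to that of \<open>Im z\<close>,
  so the logarithmic derivative has no non-real zero.\<close>

lemma pderiv_roots_poly_real_zeros:
  fixes M :: "real multiset" and z :: complex
  assumes "M \<noteq> {#}" and "poly (map_poly of_real (pderiv (roots_poly M))) z = 0"
  shows "z \<in> \<real>"
proof (rule ccontr)
  assume nr: "z \<notin> \<real>"
  let ?M = "image_mset complex_of_real M"
  have im: "Im z \<noteq> 0" using nr complex_is_Real_iff by blast
  have nin: "z \<notin># ?M" using nr by auto
  have md: "map_poly complex_of_real (pderiv p) = pderiv (map_poly of_real p)" for p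
    by (rule poly_eqI) (simp add: coeff_map_poly coeff_pderiv)
  have zero: "(\<Sum>a\<in>#?M. 1 / (z - a)) = 0"
  proof -
    have "poly (pderiv (roots_poly ?M)) z = 0"
      using assms(2) unfolding md map_poly_roots_poly .
    with nin show ?thesis
      unfolding pderiv_roots_poly_log_deriv[OF nin] mult_eq_0_iff poly_roots_poly_eq_0 by blast
  qed
  have "Im z * Im (\<Sum>a\<in>#image_mset complex_of_real N. 1 / (z - a)) < 0"
    if "N \<noteq> {#}" for N :: "real multiset"
    using that
  proof (induction N)
    case (add a N)
    have nz: "z \<noteq> of_real a" using nr by auto
    have "Im z * Im (1 / (z - of_real a)) = - ((Im z)\<^sup>2 / (cmod (z - of_real a))\<^sup>2)"
      unfolding Im_divide cmod_power2 by (simp add: power2_eq_square)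
    also have "\<dots> < 0" using im nz by simp
    finally have *: "Im z * Im (1 / (z - of_real a)) < 0" .
    show ?case
    proof (cases "N = {#}")
      case True with * show ?thesis by simp
    next
      case False
      from add.IH[OF this] * show ?thesis by (simp add: distrib_left)
    qed
  qed simp
  from this[OF assms(1)] show False unfolding zero by simp
qed

text \<open>All complex zeros of the derivative are real, so it splits over the reals, with the
  original degree as leading coefficient.\<close>

lemma pderiv_roots_poly:
  fixes M :: "real multiset"
  assumes "size M = Suc d"
  obtains M' where "size M' = d" "pderiv (roots_poly M) = smult (real (Suc d)) (roots_poly M')"
proof -
  let ?q = "pderiv (roots_poly M)"
  have deg: "degree ?q = d" using assms by (simp add: degree_pderiv)
  have lc: "lead_coeff ?q = real (Suc d)"
    unfolding deg using lead_coeff_roots_poly[of M] assms by (simp add: coeff_pderiv)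
  then have nz: "?q \<noteq> 0" by auto
  have ne: "M \<noteq> {#}" using assms by auto
  note fac = real_rooted_factorization[OF nz pderiv_roots_poly_real_zeros[OF ne]]
  show ?thesis
    by (rule that[of "proots ?q"]) (use fac lc deg in metis)+
qed

lemma higher_pderiv_roots_poly:
  fixes M :: "real multiset"
  assumes "d \<le> size M"
  obtains M' C where "size M' + d = size M" "C > 0"
    "(pderiv ^^ d) (roots_poly M) = smult C (roots_poly M')"
proof -
  have "\<exists>M' C. size M' + d = size M \<and> C > 0 \<and> (pderiv ^^ d) (roots_poly M) = smult C (roots_poly M')"
    using assms
  proof (induction d)
    case 0
    show ?case by (intro exI[of _ M] exI[of _ 1]) simp
  next
    case (Suc d)
    then obtain M' C where M': "size M' + d = size M" "C > 0"
      "(pderiv ^^ d) (roots_poly M) = smult C (roots_poly M')" by auto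
    then obtain j where j: "size M' = Suc j"
      using Suc.prems by (cases "size M'") linarith+
    obtain M'' where "size M'' = j" "pderiv (roots_poly M') = smult (real (Suc j)) (roots_poly M'')"
      by (rule pderiv_roots_poly[OF j])
    with M' j show ?case
      by (intro exI[of _ M''] exI[of _ "C * real (Suc j)"]) (simp add: pderiv_smult)
  qed
  with that show ?thesis by blast
qed

section \<open>Positivity on half-lines, under differentiation and removal of roots\<close>

text \<open>Positivity on a half-line encodes that the largest root lies below \<open>c\<close>.
  This form is stable under positive scaling and applies to derivatives without naming their
  roots.\<close>

lemma roots_poly_pos_iff:
  fixes M :: "real multiset"
  shows "(\<forall>t\<ge>c. poly (roots_poly M) t > 0) \<longleftrightarrow> (\<forall>a\<in>#M. a < c)"
proof
  assume pos: "\<forall>t\<ge>c. poly (roots_poly M) t > 0"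
  show "\<forall>a\<in>#M. a < c"
  proof (intro ballI, rule ccontr)
    fix a assume "a \<in># M" "\<not> a < c"
    with pos have "poly (roots_poly M) a > 0" by auto
    with \<open>a \<in># M\<close> show False by (metis less_irrefl poly_roots_poly_eq_0)
  qed
next
  assume "\<forall>a\<in>#M. a < c"
  then show "\<forall>t\<ge>c. poly (roots_poly M) t > 0"
    by (induction M) (auto simp: poly_roots_poly)
qed

lemma pderiv_roots_poly_pos:
  fixes M :: "real multiset"
  assumes "M \<noteq> {#}" "\<forall>a\<in>#M. a < t"
  shows "poly (pderiv (roots_poly M)) t > 0"
proof -
  have "t \<notin># M" using assms by auto
  moreover have "poly (roots_poly M) t > 0" using assms(2) roots_poly_pos_iff[of t M] by auto
  moreover have "(\<Sum>a\<in>#M. 1 / (t - a)) > 0"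
    using assms
  proof (induction M)
    case (add a M)
    then show ?case by (cases "M = {#}") (auto intro: add_pos_pos)
  qed simp
  ultimately show ?thesis by (subst pderiv_roots_poly_log_deriv) auto
qed

text \<open>Beyond all roots every summand of the logarithmic derivative is positive. The bound
  \<open>d < size M\<close> makes the \<open>d\<close>-th derivative nonconstant, so that this sum
  is not empty.\<close>

lemma higher_pderiv_roots_poly_pos_Suc:
  fixes M :: "real multiset"
  assumes "d < size M" "\<forall>t\<ge>c. poly ((pderiv ^^ d) (roots_poly M)) t > 0"
  shows "\<forall>t\<ge>c. poly ((pderiv ^^ Suc d) (roots_poly M)) t > 0"
proof -
  obtain M' C where M': "size M' + d = size M" "C > 0"
    "(pderiv ^^ d) (roots_poly M) = smult C (roots_poly M')"
    using higher_pderiv_roots_poly[of d M] assms(1) by auto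
  with assms have "\<forall>t\<ge>c. poly (roots_poly M') t > 0" by (simp add: zero_less_mult_iff)
  then have "\<forall>a\<in>#M'. a < c" by (simp add: roots_poly_pos_iff)
  moreover have "M' \<noteq> {#}" using M' assms(1) by auto
  ultimately show ?thesis using M'(2)
    by (auto simp: M'(3) pderiv_smult intro!: mult_pos_pos pderiv_roots_poly_pos)
qed

lemma higher_pderiv_roots_poly_pos_mono:
  fixes M :: "real multiset"
  assumes "d \<le> d'" "d' \<le> size M" "\<forall>t\<ge>c. poly ((pderiv ^^ d) (roots_poly M)) t > 0"
  shows "\<forall>t\<ge>c. poly ((pderiv ^^ d') (roots_poly M)) t > 0"
  using assms(1,2)
proof (induction rule: dec_induct)
  case base
  show ?case by (rule assms(3))
next
  case (step i)
  then show ?case by (intro higher_pderiv_roots_poly_pos_Suc) auto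
qed
text \<open>Leibniz rule for a factor whose second derivative vanishes. At \<open>d = 0\<close> the
  truncated index \<open>d - 1\<close> comes with the coefficient 0.\<close>

lemma higher_pderiv_linear_mult:
  "(pderiv ^^ d) ([:- z, 1:] * g) = [:- z, 1:] * (pderiv ^^ d) g + smult (of_nat d) ((pderiv ^^ (d - 1)) g)"
  for g :: "'a::field_char_0 poly"
proof (induction d)
  case (Suc d)
  have "smult (of_nat d) (pderiv ((pderiv ^^ (d - 1)) g)) = smult (of_nat d) ((pderiv ^^ d) g)"
    by (cases d) auto
  then show ?case
    unfolding funpow.simps o_apply Suc
    by (simp add: pderiv_add pderiv_mult pderiv_smult pderiv_pCons smult_add_left ac_simps
        del: mult_pCons_left mult_pCons_right)
qed simp

text \<open>Let \<open>u\<close> be the largest root of the \<open>d\<close>-th derivative of \<open>g\<close>.  Then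
  \<open>((t - z) g)\<^sup>(\<^sup>d\<^sup>)\<close> takes the value \<open>d g\<^sup>(\<^sup>d\<^sup>-\<^sup>1\<^sup>)(u)\<close> at \<open>u\<close>, which is not positive
  because \<open>u\<close> is also the largest critical point of \<open>g\<^sup>(\<^sup>d\<^sup>-\<^sup>1\<^sup>)\<close>.\<close>

lemma higher_pderiv_pos_remove_root:
  fixes M :: "real multiset"
  assumes d: "d \<le> size M"
    and pos: "\<forall>t\<ge>c. poly ((pderiv ^^ d) (roots_poly (add_mset z M))) t > 0"
  shows "\<forall>t\<ge>c. poly ((pderiv ^^ d) (roots_poly M)) t > 0"
proof -
  obtain U C where U: "size U + d = size M" "C > 0"
    "(pderiv ^^ d) (roots_poly M) = smult C (roots_poly U)"
    using higher_pderiv_roots_poly[OF d] by auto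
  have "\<forall>a\<in>#U. a < c"
  proof (rule ccontr)
    assume "\<not> (\<forall>a\<in>#U. a < c)"
    then obtain a where a: "a \<in># U" "c \<le> a" by auto
    define u where "u = Max (set_mset U)"
    have uU: "u \<in># U" unfolding u_def using a by (intro Max_in) auto
    have umax: "b \<le> u" if "b \<in># U" for b unfolding u_def using that by simp
    have uc: "c \<le> u" using a umax by fastforce
    have u0: "poly ((pderiv ^^ d) (roots_poly M)) u = 0" using uU by (simp add: U(3))
    have "poly ((pderiv ^^ d) (roots_poly (add_mset z M))) u > 0" using pos uc by auto
    then have pp: "real d * poly ((pderiv ^^ (d - 1)) (roots_poly M)) u > 0"
      using u0 by (simp add: higher_pderiv_linear_mult del: mult_pCons_left)
    then obtain d' where d': "d = Suc d'" by (cases d) auto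
    obtain V D where V: "size V + d' = size M" "D > 0"
      "(pderiv ^^ d') (roots_poly M) = smult D (roots_poly V)"
      using higher_pderiv_roots_poly[of d' M] d d' by auto
    have eq: "smult D (pderiv (roots_poly V)) = smult C (roots_poly U)"
      using U(3) V(3) by (simp add: d' pderiv_smult)
    have Gu: "poly (roots_poly V) u > 0"
      using pp V by (auto simp: d' zero_less_mult_iff)
    \<comment> \<open>Right of \<open>u\<close>, the largest zero of its derivative,
      \<open>roots_poly V\<close> does not decrease and starts from a positive value. Hence all its
      roots lie left of \<open>u\<close>, which forces a strictly positive derivative at
      \<open>u\<close>, a contradiction.\<close>
    have "poly (roots_poly V) t > 0" if "t \<ge> u" for t
    proof -
      have "poly (pderiv (roots_poly V)) s \<ge> 0" if "s \<ge> u" for s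
      proof -
        have "\<forall>a\<in>#U. a \<le> s" using umax that by force
        then have "poly (roots_poly U) s \<ge> 0"
          by (induction U) (auto simp del: mult_pCons_left intro!: mult_nonneg_nonneg)
        then have "D * poly (pderiv (roots_poly V)) s \<ge> 0"
          using U(2) arg_cong[OF eq, of "\<lambda>p. poly p s"] by simp
        then show ?thesis using V(2) by (simp add: zero_le_mult_iff)
      qed
      then have "poly (roots_poly V) u \<le> poly (roots_poly V) t"
        by (intro DERIV_nonneg_imp_nondecreasing[OF that]) (meson poly_DERIV)
      with Gu show ?thesis by simp
    qed
    then have "\<forall>a\<in>#V. a < u" using roots_poly_pos_iff[of u V] by auto
    moreover have "V \<noteq> {#}" using V d d' by auto
    ultimately have "poly (pderiv (roots_poly V)) u > 0" by (intro pderiv_roots_poly_pos)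
    moreover have "poly (smult D (pderiv (roots_poly V))) u = 0" unfolding eq using uU by simp
    ultimately show False using V(2) by simp
  qed
  then show ?thesis using U roots_poly_pos_iff[of c U] by simp
qed

lemma higher_pderiv_pos_subset:
  fixes M :: "real multiset"
  assumes "d \<le> size M"
    and "\<forall>t\<ge>c. poly ((pderiv ^^ d) (roots_poly (M + N))) t > 0"
  shows "\<forall>t\<ge>c. poly ((pderiv ^^ d) (roots_poly M)) t > 0"
  using assms(2)
proof (induction N)
  case (add z N)
  have "d \<le> size (M + N)" using assms(1) by simp
  then show ?case
    using add higher_pderiv_pos_remove_root[of d "M + N" c z] by simp
qed simp

section \<open>Linear derivatives and the mean of the roots\<close>

lemma higher_pderiv_roots_poly_const:
  "(pderiv ^^ size M) (roots_poly M) = [:fact (size M):]"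
proof (induction M)
  case (add z M)
  have "(pderiv ^^ Suc (size M)) (roots_poly M) = 0" by (simp add: add pderiv_pCons)
  then show ?case
    using add by (simp add: higher_pderiv_linear_mult del: mult_pCons_left funpow.simps)
qed simp

text \<open>The one remaining root is the mean of \<open>M\<close>, so positivity of this derivative
  at a point turns into a bound on \<open>sum_mset M\<close>.\<close>

lemma higher_pderiv_roots_poly_linear:
  assumes "size M = Suc d"
  shows "(pderiv ^^ d) (roots_poly M) = smult (fact d) [:- sum_mset M, of_nat (Suc d):]"
  using assms
proof (induction d arbitrary: M)
  case 0
  then obtain z where "M = {#z#}" using size_1_singleton_mset by auto
  then show ?case by simp
next
  case (Suc d)
  then obtain z M' where M: "M = add_mset z M'"
    using size_eq_Suc_imp_eq_union by blast
  with Suc.prems have M': "size M' = Suc d" by simp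
  have c: "(pderiv ^^ Suc d) (roots_poly M') = [:fact (Suc d):]"
    using higher_pderiv_roots_poly_const[of M'] unfolding M' .
  show ?case
    unfolding M image_mset_add_mset prod_mset.add_mset higher_pderiv_linear_mult c
      diff_Suc_1 Suc.IH[OF M'] by (simp add: algebra_simps)
qed

text \<open>Further differentiation takes both sides to the same linear polynomial, whose root is
  the mean of either multiset of roots.\<close>

lemma higher_pderiv_roots_poly_mean:
  fixes M :: "real multiset"
  assumes "(pderiv ^^ d) (roots_poly M) = smult C (roots_poly M')"
    and "size M' + d = size M" "M' \<noteq> {#}"
  shows "real (size M) * sum_mset M' = real (size M') * sum_mset M"
proof -
  obtain j where j: "size M' = Suc j" using assms(3) by (cases "size M'") auto
  have sM: "size M = Suc (j + d)" using j assms(2) by simp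
  have "(pderiv ^^ (j + d)) (roots_poly M) = smult C ((pderiv ^^ j) (roots_poly M'))"
    by (simp add: funpow_add assms(1) higher_pderiv_smult)
  then have eq: "smult (fact (j + d)) [:- sum_mset M, real (Suc (j + d)):]
      = smult C (smult (fact j) [:- sum_mset M', real (Suc j):])"
    by (simp only: higher_pderiv_roots_poly_linear[OF j] higher_pderiv_roots_poly_linear[OF sM])
  from arg_cong[OF eq, of "\<lambda>p. coeff p 0"] arg_cong[OF eq, of "\<lambda>p. coeff p 1"]
  have 0: "fact (j + d) * sum_mset M = C * fact j * sum_mset M'"
    and 1: "fact (j + d) * real (Suc (j + d)) = C * fact j * real (Suc j)" by simp_all
  have "fact (j + d) * (real (size M) * sum_mset M') = C * fact j * real (Suc j) * sum_mset M'"
    using 1 sM by (simp add: mult.assoc)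
  also have "\<dots> = fact (j + d) * (real (size M') * sum_mset M)" using 0 j by simp
  finally show ?thesis by simp
qed

section \<open>Contraction of the largest root towards the mean\<close>

lemma harmonic_arithmetic_mean_mset:
  fixes N :: "real multiset"
  assumes "\<forall>b\<in>#N. b > 0" "N \<noteq> {#}"
  shows "(real (size N))\<^sup>2 \<le> (\<Sum>b\<in>#N. 1 / b) * sum_mset N"
proof -
  define \<beta> where "\<beta> = sum_mset N / real (size N)"
  have sz: "real (size N) > 0" using assms(2) by (simp add: nonempty_has_size)
  have sp: "sum_mset N > 0" using assms
  proof (induction N)
    case (add a N)
    then show ?case by (cases "N = {#}") (auto intro: add_pos_pos)
  qed simp
  have b: "\<beta> > 0" using sp sz by (simp add: \<beta>_def)
  \<comment> \<open>The right-hand summand is the tangent to \<open>1 / b\<close> at the mean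
    \<beta>, which lies below the convex graph.\<close>
  have "(\<Sum>b\<in>#N. 1 / b) \<ge> (\<Sum>b\<in>#N. 2 / \<beta> - b / \<beta>\<^sup>2)"
  proof (rule sum_mset_mono)
    fix x assume "x \<in># N"
    then have x: "x > 0" using assms by auto
    have "0 \<le> (x - \<beta>)\<^sup>2 / (x * \<beta>\<^sup>2)" using x by simp
    also have "\<dots> = 1 / x - (2 / \<beta> - x / \<beta>\<^sup>2)"
      using x b by (simp add: field_simps power2_eq_square)
    finally show "2 / \<beta> - x / \<beta>\<^sup>2 \<le> 1 / x" by simp
  qed
  also have "(\<Sum>b\<in>#N. 2 / \<beta> - b / \<beta>\<^sup>2) = real (size N) * (2 / \<beta>) - sum_mset N / \<beta>\<^sup>2"
    by (induction N) (auto simp: algebra_simps add_divide_distrib)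
  also have "\<dots> = (real (size N))\<^sup>2 / sum_mset N"
    using sz sp by (simp add: \<beta>_def field_simps power2_eq_square)
  finally show ?thesis using sp by (simp add: pos_divide_le_eq)
qed

text \<open>If \<open>c\<close> lies below the largest root \<open>z\<^sub>1\<close>, then all other roots are below \<open>c\<close> and
  the sign of the logarithmic derivative at \<open>c\<close> says \<open>(z\<^sub>1 - c) (\<Sum>a. 1 / (c - a)) < 1\<close>;
  the harmonic mean of the \<open>c - a\<close> is at most their arithmetic mean.\<close>

lemma pderiv_pos_root_bound:
  fixes M :: "real multiset"
  assumes sz: "size M = m" "m \<ge> 2"
    and pos: "\<forall>t\<ge>c. poly (pderiv (roots_poly M)) t > 0"
    and z: "z \<in># M" and \<zeta>: "sum_mset M = real m * \<zeta>"
  shows "(real m - 2) * (z - \<zeta>) < (real m - 1) * (c - \<zeta>)"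
proof -
  define z1 where "z1 = Max (set_mset M)"
  have z1M: "z1 \<in># M" unfolding z1_def using z by (intro Max_in) auto
  have z1max: "a \<le> z1" if "a \<in># M" for a unfolding z1_def using that by simp
  obtain N where M: "M = add_mset z1 N" using z1M by (metis multi_member_split)
  have sN: "size N = m - 1" "N \<noteq> {#}" using sz M by auto
  have rm: "real (size N) = real m - 1" "real m \<ge> 2" using sN sz by auto
  have "sum_mset M \<le> (\<Sum>a\<in>#M. z1)"
    using z1max sum_mset_mono[of M "\<lambda>a. a" "\<lambda>_. z1"] by simp
  then have "real m * \<zeta> \<le> real m * z1" using \<zeta> sz by simp
  then have z1\<zeta>: "\<zeta> \<le> z1" using rm by simp
  have "(real m - 2) * (z1 - \<zeta>) < (real m - 1) * (c - \<zeta>)"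
  proof (cases "z1 < c")
    case True
    have "(real m - 2) * (z1 - \<zeta>) \<le> (real m - 1) * (z1 - \<zeta>)"
      using z1\<zeta> by (intro mult_right_mono) auto
    also have "\<dots> < (real m - 1) * (c - \<zeta>)"
      using True rm by (intro mult_strict_left_mono) auto
    finally show ?thesis .
  next
    case False
    then have cz: "c \<le> z1" by simp
    \<comment> \<open>Otherwise the second largest root \<open>y\<close> satisfies
      \<open>c \<le> y\<close>. At \<open>y\<close> the derivative reduces to \<open>y - z1\<close>
      times a nonnegative product, contrary to \<open>pos\<close>.\<close>
    have Nc: "\<forall>a\<in>#N. a < c"
    proof (rule ccontr)
      assume "\<not> (\<forall>a\<in>#N. a < c)"
      then obtain a where a: "a \<in># N" "c \<le> a" by auto
      define y where "y = Max (set_mset N)"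
      have yN: "y \<in># N" unfolding y_def using a by (intro Max_in) auto
      have ymax: "b \<le> y" if "b \<in># N" for b unfolding y_def using that by simp
      have yc: "c \<le> y" using a ymax by fastforce
      have yz: "y \<le> z1" using z1max yN M by auto
      obtain L where N: "N = add_mset y L" using yN by (metis multi_member_split)
      have "\<forall>b\<in>#L. b \<le> y" using ymax N by auto
      then have Ly: "poly (roots_poly L) y \<ge> 0"
        by (induction L) (auto simp del: mult_pCons_left intro!: mult_nonneg_nonneg)
      have "poly (pderiv (roots_poly M)) y = (y - z1) * poly (roots_poly L) y"
        unfolding M N image_mset_add_mset prod_mset.add_mset pderiv_mult
        by (simp add: pderiv_pCons del: mult_pCons_left)
      also have "\<dots> \<le> 0" using yz Ly by (intro mult_nonpos_nonneg) auto
      finally show False using pos yc by force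
    qed
    define S where "S = (\<Sum>a\<in>#N. 1 / (c - a))"
    define P where "P = (\<Sum>a\<in>#N. c - a)"
    have hc: "poly (roots_poly N) c > 0" using roots_poly_pos_iff[of c N] Nc by auto
    have "0 < poly (pderiv (roots_poly M)) c" using pos by auto
    also have "\<dots> = poly (roots_poly N) c + (c - z1) * poly (pderiv (roots_poly N)) c"
      unfolding M image_mset_add_mset prod_mset.add_mset pderiv_mult
      by (simp add: pderiv_pCons del: mult_pCons_left)
    also have "\<dots> = poly (roots_poly N) c * (1 - (z1 - c) * S)"
      using Nc by (subst pderiv_roots_poly_log_deriv) (auto simp: S_def algebra_simps)
    finally have S1: "(z1 - c) * S < 1" using hc by (simp add: zero_less_mult_iff)
    have P: "P = (real m - 1) * c - (real m * \<zeta> - z1)"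
    proof -
      have "P = real (size N) * c - sum_mset N"
        unfolding P_def by (induction N) (auto simp: algebra_simps)
      with \<zeta> rm M show ?thesis by simp
    qed
    have AH: "(real (size N))\<^sup>2 \<le> S * P"
      using harmonic_arithmetic_mean_mset[of "image_mset (\<lambda>a. c - a) N"] Nc sN(2)
      by (simp add: S_def P_def image_mset.compositionality o_def)
    have Ppos: "P > 0"
    proof -
      have "S \<ge> 0" unfolding S_def using Nc by (induction N) auto
      moreover have "0 < (real (size N))\<^sup>2" using rm by simp
      then have "S * P > 0" using AH by linarith
      ultimately show ?thesis by (simp add: zero_less_mult_iff)
    qed
    have "(z1 - c) * (real m - 1)\<^sup>2 \<le> (z1 - c) * (S * P)"
      using AH cz rm by (intro mult_left_mono) auto
    also have "\<dots> < P" using mult_strict_right_mono[OF S1 Ppos] by (simp add: mult.assoc)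
    finally have "(z1 - c) * (real m - 1)\<^sup>2 < (real m - 1) * c - (real m * \<zeta> - z1)"
      unfolding P .
    \<comment> \<open>After collecting terms, \<open>z1\<close>, \<open>c\<close> and \<zeta> have
      the coefficients \<open>m (m - 2)\<close>, \<open>- m (m - 1)\<close> and \<open>m\<close>, so
      a common factor \<open>m\<close> splits off.\<close>
    then have "real m * ((real m - 2) * (z1 - \<zeta>)) < real m * ((real m - 1) * (c - \<zeta>))"
      by (simp add: power2_eq_square algebra_simps)
    then show ?thesis using rm by simp
  qed
  moreover have "(real m - 2) * (z - \<zeta>) \<le> (real m - 2) * (z1 - \<zeta>)"
    using z1max[OF z] rm by (intro mult_left_mono) auto
  ultimately show ?thesis by simp
qed

text \<open>Differentiation fixes the mean \<zeta>, and one step from degree \<open>m\<close> costs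
  the factor \<open>(m - 1) / (m - 2)\<close>. Over \<open>m = k + 1, ..., k + j\<close> these
  factors telescope to \<open>(k + j - 1) / (k - 1)\<close>.\<close>

lemma higher_pderiv_pos_root_bound:
  fixes M :: "real multiset"
  assumes "size M = k + j" "k \<ge> 2"
    and "\<forall>t\<ge>c. poly ((pderiv ^^ j) (roots_poly M)) t > 0"
    and "z \<in># M" and "sum_mset M = real (k + j) * \<zeta>"
  shows "(real k - 1) * (z - \<zeta>) < (real (k + j) - 1) * (c - \<zeta>)"
  using assms(1,3-5)
proof (induction j arbitrary: M z)
  case 0
  then have "\<forall>a\<in>#M. a < c" using roots_poly_pos_iff[of c M] by simp
  then have "z < c" using 0 by simp
  then show ?case using assms(2) by simp
next
  case (Suc j)
  have sz: "size M = Suc (k + j)" using Suc.prems by simp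
  obtain M' where M': "size M' = k + j"
    "pderiv (roots_poly M) = smult (real (Suc (k + j))) (roots_poly M')"
    by (rule pderiv_roots_poly[OF sz])
  have "real (size M) * sum_mset M' = real (size M') * sum_mset M"
    by (rule higher_pderiv_roots_poly_mean[of 1 _ "real (Suc (k + j))"])
      (use M' sz assms(2) in auto)
  then have mean: "sum_mset M' = real (k + j) * \<zeta>"
    using Suc.prems(4) sz M'(1) by (simp add: field_simps del: of_nat_Suc of_nat_add)
  have "(pderiv ^^ Suc j) (roots_poly M) = smult (real (Suc (k + j))) ((pderiv ^^ j) (roots_poly M'))"
    unfolding funpow_Suc_right o_apply M'(2) higher_pderiv_smult ..
  with Suc.prems(2) have pos': "\<forall>t\<ge>c. poly ((pderiv ^^ j) (roots_poly M')) t > 0"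
    by (simp add: zero_less_mult_iff del: funpow.simps)
  \<comment> \<open>\<open>c'\<close> is the bound that the induction hypothesis puts on every root
    of the first derivative.\<close>
  define c' where "c' = \<zeta> + (real (k + j) - 1) * (c - \<zeta>) / (real k - 1)"
  have k1: "real k - 1 > 0" using assms(2) by simp
  have "\<forall>a\<in>#M'. a < c'"
  proof
    fix a assume "a \<in># M'"
    from Suc.IH[OF M'(1) pos' this mean]
    show "a < c'" using k1 by (simp add: c'_def field_simps)
  qed
  then have "\<forall>t\<ge>c'. poly (pderiv (roots_poly M)) t > 0"
    using roots_poly_pos_iff[of c' M'] by (simp add: M'(2))
  from pderiv_pos_root_bound[OF sz _ this Suc.prems(3), of \<zeta>]
  have "(real (Suc (k + j)) - 2) * (z - \<zeta>) < (real (Suc (k + j)) - 1) * (c' - \<zeta>)"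
    using Suc.prems(4) assms(2) by simp
  then have "(real (k + j) - 1) * (z - \<zeta>) < (real (k + j) - 1) * (real (k + j) * (c - \<zeta>) / (real k - 1))"
    by (simp add: c'_def algebra_simps)
  then have "z - \<zeta> < real (k + j) * (c - \<zeta>) / (real k - 1)"
    using assms(2) by (subst (asm) mult_less_cancel_left_pos) auto
  then show ?case using k1 by (simp add: field_simps)
qed

text \<open>When \<open>n - k > k - 2\<close>, the \<open>(k - 2)\<close>-nd derivative has a root at least as large as
  the mean of \<open>T\<close>, because it is linear after discarding \<open>H\<close>; the remaining \<open>n - 2 k + 2\<close>
  derivatives are controlled by \<open>higher_pderiv_pos_root_bound\<close>.\<close>

lemma higher_pderiv_pos_sum_bounds:
  fixes H T :: "real multiset"
  assumes nk: "2 \<le> k" "k < n"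
    and sz: "size H = n - k + 1" "size T = k - 1"
    and pos: "\<forall>t\<ge>0. poly ((pderiv ^^ (n - k)) (roots_poly (H + T))) t > 0"
  shows "sum_mset H < 0"
    and "real n * sum_mset T + real (n - k) * sum_mset (H + T) \<le> 0"
proof -
  have szA: "size (H + T) = n" using sz nk by simp
  have lin: "sum_mset M < real (Suc d) * t"
    if "size M = Suc d" "poly ((pderiv ^^ d) (roots_poly M)) t > 0" for M :: "real multiset" and d t
  proof -
    have "(fact d :: real) * (real (Suc d) * t - sum_mset M) > 0"
      using that(2) unfolding higher_pderiv_roots_poly_linear[OF that(1)]
      by (simp add: algebra_simps)
    then show ?thesis by (simp add: zero_less_mult_iff)
  qed
  \<comment> \<open>\<open>H\<close> has \<open>n - k + 1\<close> elements, so this derivative is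
    linear and \<open>lin\<close> applies at 0.\<close>
  have "\<forall>t\<ge>0. poly ((pderiv ^^ (n - k)) (roots_poly H)) t > 0"
    using higher_pderiv_pos_subset[of "n - k" H 0 T] sz pos by simp
  then show "sum_mset H < 0" using lin[of H "n - k" 0] sz by simp
  have "\<forall>t\<ge>0. poly ((pderiv ^^ (n - 1)) (roots_poly (H + T))) t > 0"
    by (rule higher_pderiv_roots_poly_pos_mono[OF _ _ pos]) (use szA nk in auto)
  then have A0: "sum_mset (H + T) < 0" using lin[of "H + T" "n - 1" 0] szA nk by simp
  show "real n * sum_mset T + real (n - k) * sum_mset (H + T) \<le> 0"
  proof (cases "n - k \<le> k - 2")
    case True
    \<comment> \<open>Here \<open>T\<close> has more than \<open>n - k\<close> elements, so
      \<open>H\<close> can be discarded; differentiating on to order \<open>k - 2\<close> makes the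
      polynomial of \<open>T\<close> linear.\<close>
    have "\<forall>t\<ge>0. poly ((pderiv ^^ (n - k)) (roots_poly T)) t > 0"
      by (rule higher_pderiv_pos_subset[of _ _ _ H]) (use True pos sz nk in \<open>auto simp: add.commute\<close>)
    then have "\<forall>t\<ge>0. poly ((pderiv ^^ (k - 2)) (roots_poly T)) t > 0"
      by (rule higher_pderiv_roots_poly_pos_mono[rotated 2]) (use True sz in auto)
    then have "sum_mset T < 0" using lin[of T "k - 2" 0] sz nk by simp
    then show ?thesis
      using A0 by (intro add_nonpos_nonpos mult_nonneg_nonpos) auto
  next
    case False
    \<comment> \<open>The subtraction does not truncate: this case gives
      \<open>2 * k - 1 \<le> n\<close>, hence \<open>j \<ge> 1\<close>.\<close>
    define j where "j = n + 2 - 2 * k"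
    have j: "n - k = j + (k - 2)" "size (H + T) = k + j + (k - 2)"
      using False nk szA unfolding j_def by linarith+
    obtain W C where W: "size W + (k - 2) = size (H + T)" "C > 0"
      "(pderiv ^^ (k - 2)) (roots_poly (H + T)) = smult C (roots_poly W)"
      by (rule higher_pderiv_roots_poly[of "k - 2" "H + T"]) (use j in auto)
    have szW: "size W = k + j" using W(1) j(2) by linarith
    have k1: "k - 1 = Suc (k - 2)" using nk by simp
    define \<tau> where "\<tau> = sum_mset T / real (k - 1)"
    \<comment> \<open>If all roots were below \<tau>, discarding \<open>H\<close> would leave a
      linear derivative positive at \<tau>, although \<tau> is its root.\<close>
    have "\<exists>w\<in>#W. \<tau> \<le> w"
    proof (rule ccontr)
      assume "\<not> (\<exists>w\<in>#W. \<tau> \<le> w)"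
      then have "\<forall>t\<ge>\<tau>. poly (roots_poly W) t > 0" using roots_poly_pos_iff[of \<tau> W] by force
      then have "\<forall>t\<ge>\<tau>. poly ((pderiv ^^ (k - 2)) (roots_poly (T + H))) t > 0"
        using W(2) unfolding add.commute[of T H] W(3) by simp
      then have "\<forall>t\<ge>\<tau>. poly ((pderiv ^^ (k - 2)) (roots_poly T)) t > 0"
        by (rule higher_pderiv_pos_subset[rotated]) (use sz in auto)
      then have "sum_mset T < real (k - 1) * \<tau>"
        using lin[of T "k - 2" \<tau>] sz k1 by (simp del: of_nat_Suc)
      then show False using nk by (simp add: \<tau>_def)
    qed
    then obtain w where w: "w \<in># W" "\<tau> \<le> w" by blast
    define \<zeta> where "\<zeta> = sum_mset (H + T) / real n"
    have "real n * sum_mset W = real (k + j) * sum_mset (H + T)"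
      using higher_pderiv_roots_poly_mean[OF W(3) W(1)] szW szA nk by fastforce
    then have mean: "sum_mset W = real (k + j) * \<zeta>"
      using nk by (simp add: \<zeta>_def field_simps)
    have "(pderiv ^^ (n - k)) (roots_poly (H + T)) = smult C ((pderiv ^^ j) (roots_poly W))"
      unfolding j(1) funpow_add o_apply W(3) higher_pderiv_smult ..
    with pos W(2) have "\<forall>t\<ge>0. poly ((pderiv ^^ j) (roots_poly W)) t > 0"
      by (simp add: zero_less_mult_iff)
    from higher_pderiv_pos_root_bound[OF szW nk(1) this w(1) mean]
    have "(real k - 1) * (w - \<zeta>) < - ((real (k + j) - 1) * \<zeta>)" by simp
    moreover have "(real k - 1) * (\<tau> - \<zeta>) \<le> (real k - 1) * (w - \<zeta>)"
      using w(2) nk by (intro mult_left_mono) auto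
    moreover have "(real k - 1) * \<tau> = sum_mset T"
      using nk by (simp add: \<tau>_def of_nat_diff)
    \<comment> \<open>The terms \<open>(k - 1) * \<zeta>\<close> cancel. Since \<zeta> is negative,
      \<open>j\<close> may then be enlarged to \<open>n - k\<close>.\<close>
    ultimately have "sum_mset T < - (real j * \<zeta>)" by (simp add: algebra_simps)
    moreover have "\<zeta> < 0" using A0 nk by (simp add: \<zeta>_def divide_neg_pos)
    moreover have "real j \<le> real (n - k)" using j(1) by simp
    ultimately have "sum_mset T \<le> - (real (n - k) * \<zeta>)"
      by (smt (verit) mult_right_mono_neg)
    then have "real n * sum_mset T \<le> real n * (- (real (n - k) * \<zeta>))"
      by (intro mult_left_mono) auto
    also have "\<dots> = - (real (n - k) * sum_mset (H + T))" using nk by (simp add: \<zeta>_def)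
    finally show ?thesis by simp
  qed
qed

section \<open>Elementary symmetric polynomials as derivatives\<close>

text \<open>Each derivative deletes one factor, and \<open>d\<close> given factors can be deleted in
  \<open>d!\<close> orders. The size condition is additive so that the sum is empty for
  \<open>d > card I\<close>; a truncated \<open>card I - d\<close> would leave the empty
  set.\<close>

lemma higher_pderiv_prod_linear:
  fixes x :: "'i \<Rightarrow> real"
  assumes "finite I"
  shows "(pderiv ^^ d) (\<Prod>i\<in>I. [:x i, 1:]) =
    smult (fact d) (\<Sum>S | S \<subseteq> I \<and> card S + d = card I. \<Prod>i\<in>S. [:x i, 1:])"
  using assms
proof (induction I arbitrary: d)
  case empty
  show ?case
  proof (cases d)
    case 0
    have "{S. S = {} \<and> card S = 0} = {{} :: 'i set}" by auto
    then show ?thesis using 0 by simp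
  next
    case (Suc d')
    have "(pderiv ^^ Suc d') (1 :: real poly) = 0"
      unfolding funpow_Suc_right o_apply by simp
    moreover have "{S :: 'i set. S \<subseteq> {} \<and> card S + d = card ({} :: 'i set)} = {}"
      using Suc by auto
    ultimately show ?thesis unfolding Suc by simp
  qed
next
  case (insert a F)
  let ?E = "\<lambda>d. \<Sum>S | S \<subseteq> F \<and> card S + d = card F. \<Prod>i\<in>S. [:x i, 1:]"
  let ?A = "{S. S \<subseteq> F \<and> card S + d = Suc (card F)}"
  let ?B = "{S. S \<subseteq> F \<and> card S + d = card F}"
  have fin: "finite S" if "S \<subseteq> F" for S using that insert(1) finite_subset by blast
  \<comment> \<open>The index sets are split according to whether the new factor survives.\<close>
  have set: "{S. S \<subseteq> insert a F \<and> card S + d = card (insert a F)} = ?A \<union> insert a ` ?B"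
  proof (intro equalityI subsetI)
    fix S assume S: "S \<in> {S. S \<subseteq> insert a F \<and> card S + d = card (insert a F)}"
    show "S \<in> ?A \<union> insert a ` ?B"
    proof (cases "a \<in> S")
      case True
      have "S - {a} \<subseteq> F" using S by auto
      moreover have "card S = Suc (card (S - {a}))"
        using True S insert(1) by (intro card.remove) (auto intro: finite_subset)
      moreover have "S = insert a (S - {a})" using True by auto
      ultimately have "S - {a} \<in> ?B" "S = insert a (S - {a})" using S insert(1,2) by auto
      then show ?thesis by blast
    next
      case False
      then show ?thesis using S insert(1,2) by auto
    qed
  next
    fix S assume "S \<in> ?A \<union> insert a ` ?B"
    moreover have "card (insert a S) = Suc (card S)" if "S \<subseteq> F" for S
      using that fin insert(2) by (intro card_insert_disjoint) auto
    ultimately show "S \<in> {S. S \<subseteq> insert a F \<and> card S + d = card (insert a F)}"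
      using insert(1,2) by auto
  qed
  have "(\<Sum>S | S \<subseteq> insert a F \<and> card S + d = card (insert a F). \<Prod>i\<in>S. [:x i, 1:])
      = (\<Sum>S\<in>?A. \<Prod>i\<in>S. [:x i, 1:]) + (\<Sum>S\<in>insert a ` ?B. \<Prod>i\<in>S. [:x i, 1:])"
    unfolding set using insert(1,2) by (intro sum.union_disjoint) auto
  also have "(\<Sum>S\<in>insert a ` ?B. \<Prod>i\<in>S. [:x i, 1:]) = (\<Sum>S\<in>?B. \<Prod>i\<in>insert a S. [:x i, 1:])"
  proof (rule sum.reindex_cong[OF _ refl refl])
    show "inj_on (insert a) ?B" using insert(2)
      by (intro inj_onI) (metis (mono_tags, lifting) insert_ident mem_Collect_eq subsetD)
  qed
  also have "\<dots> = [:x a, 1:] * ?E d"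
    unfolding sum_distrib_left
    by (rule sum.cong[OF refl], rule prod.insert) (use fin insert(2) in auto)
  finally have R: "(\<Sum>S | S \<subseteq> insert a F \<and> card S + d = card (insert a F). \<Prod>i\<in>S. [:x i, 1:])
      = (\<Sum>S\<in>?A. \<Prod>i\<in>S. [:x i, 1:]) + [:x a, 1:] * ?E d" .
  \<comment> \<open>This is the Leibniz term where one derivative falls on the new factor, by
    \<open>d! = d * (d - 1)!\<close>. For \<open>d = 0\<close> both sides vanish.\<close>
  have A: "smult (fact d) (\<Sum>S\<in>?A. \<Prod>i\<in>S. [:x i, 1:]) = smult (of_nat d) (smult (fact (d - 1)) (?E (d - 1)))"
  proof (cases d)
    case 0
    have "\<not> (S \<subseteq> F \<and> card S + d = Suc (card F))" for S
      using card_mono[OF insert(1), of S] 0 by auto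
    then have A: "?A = {}" by blast
    show ?thesis unfolding A using 0 by simp
  next
    case (Suc d')
    have "?A = {S. S \<subseteq> F \<and> card S + d' = card F}" using Suc by auto
    then show ?thesis by (simp add: Suc)
  qed
  have "(pderiv ^^ d) (\<Prod>i\<in>insert a F. [:x i, 1:]) =
      (pderiv ^^ d) ([:- (- x a), 1:] * (\<Prod>i\<in>F. [:x i, 1:]))"
    using insert(1,2) by (simp del: mult_pCons_left)
  also have "\<dots> = [:x a, 1:] * smult (fact d) (?E d) + smult (of_nat d) (smult (fact (d - 1)) (?E (d - 1)))"
    unfolding higher_pderiv_linear_mult insert.IH by simp
  finally show ?case
    unfolding R smult_add_right A by (simp only: mult_smult_right add.commute)
qed

section \<open>Line polynomials and the Garding cone of \<open>esym\<close>\<close>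

lemma line_poly_eqI:
  assumes "\<And>s. poly q s = p (s *\<^sub>R a + x)"
  shows "line_poly p a x = q"
  unfolding line_poly_def
proof (rule the_equality)
  show "\<forall>s. poly q s = p (s *\<^sub>R a + x)" using assms by blast
  fix q' assume "\<forall>s. poly q' s = p (s *\<^sub>R a + x)"
  then have "poly q' = poly q" using assms by (intro ext) simp
  then show "q' = q" by (simp only: poly_eq_poly_eq_iff)
qed

abbreviation neg_coords :: "real ^ 'n \<Rightarrow> real multiset" where
  "neg_coords x \<equiv> image_mset (\<lambda>i. - x $ i) (mset_set UNIV)"

lemma line_poly_esym:
  fixes x :: "real ^ 'n::finite"
  assumes "k \<le> CARD('n)"
  shows "line_poly (esym k) 1 x =
    smult (1 / fact (CARD('n) - k)) ((pderiv ^^ (CARD('n) - k)) (roots_poly (neg_coords x)))"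
proof (rule line_poly_eqI)
  fix s :: real
  let ?d = "CARD('n) - k"
  have rp: "roots_poly (neg_coords x) = (\<Prod>i\<in>UNIV. [:x $ i, 1:])"
    by (simp add: prod_unfold_prod_mset image_mset.compositionality o_def)
  have "{S :: 'n set. S \<subseteq> UNIV \<and> card S + ?d = CARD('n)} = {S. S \<subseteq> UNIV \<and> card S = k}"
    using assms by auto
  then have "(pderiv ^^ ?d) (roots_poly (neg_coords x)) =
      smult (fact ?d) (\<Sum>S | S \<subseteq> (UNIV :: 'n set) \<and> card S = k. \<Prod>i\<in>S. [:x $ i, 1:])"
    unfolding rp using higher_pderiv_prod_linear[of "UNIV :: 'n set" ?d "\<lambda>i. x $ i"] by simp
  then show "poly (smult (1 / fact ?d) ((pderiv ^^ ?d) (roots_poly (neg_coords x)))) s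
      = esym k (s *\<^sub>R 1 + x)"
    by (simp add: esym_def poly_sum poly_prod add.commute)
qed

text \<open>The multiset \<open>proots 0\<close> is empty by convention, which is why the line
  polynomial is assumed nonzero.\<close>

lemma garding_cone_iff:
  assumes "line_poly p a x \<noteq> 0"
  shows "x \<in> garding_cone p a \<longleftrightarrow> (\<forall>t\<ge>0. poly (line_poly p a x) t \<noteq> 0)"
proof -
  have "x \<in> garding_cone p a \<longleftrightarrow> (\<forall>t. poly (line_poly p a x) t = 0 \<longrightarrow> t < 0)"
    using assms by (auto simp: garding_cone_def hyp_eigenvalues_def)
  also have "\<dots> \<longleftrightarrow> (\<forall>t\<ge>0. poly (line_poly p a x) t \<noteq> 0)"
    by (meson not_less)
  finally show ?thesis .
qed

text \<open>The derivative splits over the reals with positive leading coefficient, so having no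
  zero on the half-line already means being positive there.\<close>

lemma garding_cone_esym_iff:
  fixes x :: "real ^ 'n::finite"
  assumes "k \<le> CARD('n)"
  shows "x \<in> garding_cone (esym k) 1 \<longleftrightarrow>
    (\<forall>t\<ge>0. poly ((pderiv ^^ (CARD('n) - k)) (roots_poly (neg_coords x))) t > 0)"
proof -
  let ?d = "CARD('n) - k"
  obtain U C where U: "C > 0" "(pderiv ^^ ?d) (roots_poly (neg_coords x)) = smult C (roots_poly U)"
    by (rule higher_pderiv_roots_poly[of ?d "neg_coords x"]) auto
  have lp: "line_poly (esym k) 1 x = smult (C / fact ?d) (roots_poly U)"
    unfolding line_poly_esym[OF assms] U(2) by simp
  have "x \<in> garding_cone (esym k) 1 \<longleftrightarrow> (\<forall>t\<ge>0. t \<notin># U)"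
    using U(1) by (subst garding_cone_iff) (auto simp: lp)
  also have "\<dots> \<longleftrightarrow> (\<forall>a\<in>#U. a < 0)" by (meson not_less)
  also have "\<dots> \<longleftrightarrow> (\<forall>t\<ge>0. poly (roots_poly U) t > 0)" by (simp only: roots_poly_pos_iff)
  finally show ?thesis using U(1) by (simp add: U(2) zero_less_mult_iff)
qed

lemma positive_in_garding_cone_esym:
  fixes x :: "real ^ 'n::finite"
  assumes "k \<le> CARD('n)" "\<And>i. x $ i > 0"
  shows "x \<in> garding_cone (esym k) 1"
proof -
  have pos: "\<forall>t\<ge>0. poly ((pderiv ^^ 0) (roots_poly (neg_coords x))) t > 0"
    using assms(2) roots_poly_pos_iff[of 0 "neg_coords x"] by simp
  have "\<forall>t\<ge>0. poly ((pderiv ^^ (CARD('n) - k)) (roots_poly (neg_coords x))) t > 0"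
    by (rule higher_pderiv_roots_poly_pos_mono[OF _ _ pos]) simp_all
  then show ?thesis using garding_cone_esym_iff[OF assms(1)] by blast
qed

text \<open>\<open>H\<close> and \<open>T\<close> collect the negated head and tail coordinates.
  With head sum \<open>A\<close> and total \<open>S\<close>, the tail sum is \<open>S - A\<close>,
  and the bound \<open>n (S - A) + (n - k) S \<ge> 0\<close> rearranges to the second claim.\<close>

lemma garding_cone_esym_sum_bounds:
  fixes e :: "nat \<Rightarrow> 'n::finite" and x :: "real ^ 'n"
  assumes nk: "2 \<le> k" "k < n" and e: "bij_betw e {1..n} UNIV"
    and x: "x \<in> garding_cone (esym k) 1"
  shows "0 < (\<Sum>i=1..n-k+1. x $ e i)"
    and "real n * (\<Sum>i=1..n-k+1. x $ e i) \<le> real (2 * n - k) * (\<Sum>i=1..n. x $ e i)"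
proof -
  have card: "CARD('n) = n" using bij_betw_same_card[OF e] by simp
  define H where "H = image_mset (\<lambda>i. - x $ e i) (mset_set {1..n-k+1})"
  define T where "T = image_mset (\<lambda>i. - x $ e i) (mset_set {n-k+2..n})"
  have un: "{1..n} = {1..n-k+1} \<union> {n-k+2..n}" using nk by auto
  have "mset_set {1..n} = mset_set {1..n-k+1} + mset_set {n-k+2..n}"
    unfolding un by (rule mset_set_Union) auto
  then have "H + T = image_mset (\<lambda>i. - x $ e i) (mset_set {1..n})"
    by (simp add: H_def T_def)
  also have "\<dots> = image_mset (\<lambda>j. - x $ j) (image_mset e (mset_set {1..n}))"
    by (simp add: image_mset.compositionality o_def)
  also have "image_mset e (mset_set {1..n}) = mset_set UNIV"
    using e by (simp add: bij_betw_def image_mset_mset_set)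
  finally have HT: "H + T = neg_coords x" .
  have pos: "\<forall>t\<ge>0. poly ((pderiv ^^ (n - k)) (roots_poly (H + T))) t > 0"
    using x garding_cone_esym_iff[of k x] nk by (simp add: HT card)
  have sz: "size H = n - k + 1" "size T = k - 1" using nk by (auto simp: H_def T_def)
  have sH: "sum_mset H = - (\<Sum>i=1..n-k+1. x $ e i)"
    unfolding H_def by (simp add: sum_unfold_sum_mset[symmetric] sum_negf)
  have sT: "sum_mset T = - (\<Sum>i=n-k+2..n. x $ e i)"
    unfolding T_def by (simp add: sum_unfold_sum_mset[symmetric] sum_negf)
  have s: "(\<Sum>i=1..n. x $ e i) = (\<Sum>i=1..n-k+1. x $ e i) + (\<Sum>i=n-k+2..n. x $ e i)"
    unfolding un by (rule sum.union_disjoint) auto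
  from higher_pderiv_pos_sum_bounds[OF nk sz pos]
  have 1: "sum_mset H < 0" and 2: "real n * sum_mset T + real (n - k) * sum_mset (H + T) \<le> 0"
    by blast+
  show "0 < (\<Sum>i=1..n-k+1. x $ e i)" using 1 sH by simp
  have "real (2 * n - k) = real n + real (n - k)" using nk by simp
  then show "real n * (\<Sum>i=1..n-k+1. x $ e i) \<le> real (2 * n - k) * (\<Sum>i=1..n. x $ e i)"
    using 2 unfolding s sum_mset.union sH sT by (simp add: algebra_simps)
qed

section \<open>Products of powers of two linear forms\<close>

lemma line_poly_power_product:
  fixes f g :: "'a::euclidean_space \<Rightarrow> real"
  assumes "linear f" "linear g" "f a = 1" "g a = 1"
  shows "line_poly (\<lambda>x. f x ^ r * g x ^ s) a x = [:f x, 1:] ^ r * [:g x, 1:] ^ s"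
  by (rule line_poly_eqI)
    (simp add: linear_add[OF assms(1)] linear_add[OF assms(2)] linear_scale[OF assms(1)]
      linear_scale[OF assms(2)] assms(3,4) add.commute)

lemma hyperbolic_power_product:
  fixes f g :: "'a::euclidean_space \<Rightarrow> real"
  assumes fg: "linear f" "linear g" "f a = 1" "g a = 1" and "r > 0"
  shows "hyperbolic (r + s) (\<lambda>x. f x ^ r * g x ^ s) a"
  unfolding hyperbolic_def homogeneous_polynomial_def
proof (intro conjI allI impI)
  show "real_polynomial_function (\<lambda>x. f x ^ r * g x ^ s)"
    using fg(1,2)[THEN linear_conv_bounded_linear[THEN iffD1]]
    by (intro real_polynomial_function.intros(4) real_polynomial_function_power
        real_polynomial_function.intros(1))
  show "f (c *\<^sub>R x) ^ r * g (c *\<^sub>R x) ^ s = c ^ (r + s) * (f x ^ r * g x ^ s)" for c x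
    by (simp add: linear_scale[OF fg(1)] linear_scale[OF fg(2)] power_mult_distrib power_add)
  fix x and z :: complex
  have pw: "[:c, 1:] ^ j = roots_poly (replicate_mset j (- c))" for c :: real and j
    by (induction j) (auto simp del: mult_pCons_left)
  have "[:f x, 1:] ^ r * [:g x, 1:] ^ s = roots_poly (replicate_mset r (- f x) + replicate_mset s (- g x))"
    by (simp only: pw image_mset_union prod_mset.union)
  moreover assume "poly (map_poly of_real (line_poly (\<lambda>x. f x ^ r * g x ^ s) a x)) z = 0"
  ultimately have "z \<in># image_mset of_real (replicate_mset r (- f x) + replicate_mset s (- g x))"
    by (simp only: line_poly_power_product[OF fg] map_poly_roots_poly poly_roots_poly_eq_0)
  then show "z \<in> \<real>" by (auto split: if_splits)
qed (use assms in auto)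

lemma hyp_eigenvalues_power_product:
  fixes f g :: "'a::euclidean_space \<Rightarrow> real"
  assumes fg: "linear f" "linear g" "f a = 1" "g a = 1"
  shows "hyp_eigenvalues (\<lambda>x. f x ^ r * g x ^ s) a x = replicate_mset r (f x) + replicate_mset s (g x)"
proof -
  have "proots ([:f x, 1:] ^ r * [:g x, 1:] ^ s) = repeat_mset r {#- f x#} + repeat_mset s {#- g x#}"
    by (subst proots_mult) (auto simp: proots_power)
  then show ?thesis
    by (simp add: hyp_eigenvalues_def line_poly_power_product[OF fg] repeat_mset_replicate_mset)
qed

section \<open>The two means and their product\<close>

lemma linear_head_mean: "linear (head_mean e n k)"
  by (rule linearI)
    (simp_all add: head_mean_def sum.distrib sum_distrib_left[symmetric] add_divide_distrib
      del: sum.cl_ivl_Suc)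

lemma linear_compl_mean: "linear (compl_mean e n k q)"
proof (rule linearI)
  fix x y c
  show "compl_mean e n k q (x + y) = compl_mean e n k q x + compl_mean e n k q y"
    by (simp add: compl_mean_def linear_add[OF linear_head_mean] sum.distrib add_divide_distrib
        algebra_simps)
  show "compl_mean e n k q (c *\<^sub>R x) = c *\<^sub>R compl_mean e n k q x"
    by (simp add: compl_mean_def linear_scale[OF linear_head_mean] sum_distrib_left[symmetric]
        algebra_simps)
qed

lemma head_mean_one: "head_mean e n k 1 = 1"
  by (simp add: head_mean_def)

lemma compl_mean_one: "n > 0 \<Longrightarrow> q \<noteq> 1 \<Longrightarrow> compl_mean e n k q 1 = 1"
  by (simp add: compl_mean_def head_mean_one)

lemma mean_product_eq:
  "mean_product e n k r m =
    (\<lambda>x. head_mean e n k x ^ r * compl_mean e n k (real r / real m) x ^ (m - r))"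
  by (simp add: mean_product_def fun_eq_iff)

lemma hyp_eigenvalues_mean_product:
  assumes "n > 0" "r < m"
  shows "hyp_eigenvalues (mean_product e n k r m) 1 x =
    replicate_mset r (head_mean e n k x) + replicate_mset (m - r) (compl_mean e n k (real r / real m) x)"
  unfolding mean_product_eq
  by (rule hyp_eigenvalues_power_product)
    (use assms in \<open>simp_all add: linear_head_mean linear_compl_mean head_mean_one compl_mean_one\<close>)

lemma garding_cone_mean_product:
  assumes "n > 0" "0 < r" "r < m"
  shows "x \<in> garding_cone (mean_product e n k r m) 1 \<longleftrightarrow>
    head_mean e n k x > 0 \<and> compl_mean e n k (real r / real m) x > 0"
  using assms(2,3)
  by (auto simp: garding_cone_def hyp_eigenvalues_mean_product[OF assms(1,3)])

text \<open>The weight \<open>m - r = m (1 - q)\<close> cancels the denominator of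
  \<open>compl_mean\<close>, and the head means then cancel because \<open>r = m q\<close>. What
  remains is \<open>m\<close> times the mean of all coordinates.\<close>

lemma one_central_mean_product:
  fixes e :: "nat \<Rightarrow> 'n::finite"
  assumes n: "n > 0" and r: "0 < r" "r < m" and e: "bij_betw e {1..n} UNIV"
  shows "one_central m (mean_product e n k r m)"
  unfolding one_central_def
proof (intro conjI exI[of _ "real m / real n"] allI)
  have m: "r + (m - r) = m" using r by simp
  have q: "real r / real m \<noteq> 1" using r by simp
  show "hyperbolic m (mean_product e n k r m) 1"
    using hyperbolic_power_product[OF linear_head_mean linear_compl_mean head_mean_one
        compl_mean_one[OF n q] r(1), of "m - r"]
    unfolding m mean_product_eq .
  show "real m / real n > 0" using n r by simp
  fix x :: "real ^ 'n"
  let ?L = "head_mean e n k x"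
  define q where "q = real r / real m"
  have rq: "real r = real m * q" and q1: "q \<noteq> 1" using r by (simp_all add: q_def)
  have s: "(\<Sum>i\<in>UNIV. x $ i) = (\<Sum>i=1..n. x $ e i)"
    using sum.reindex_bij_betw[OF e, of "\<lambda>i. x $ i"] by simp
  have "hyp_trace (mean_product e n k r m) 1 x = real r * ?L + real (m - r) * compl_mean e n k q x"
    by (simp add: hyp_trace_def hyp_eigenvalues_mean_product[OF n r(2)] q_def)
  also have "real (m - r) = real m * (1 - q)" using r rq by (simp add: of_nat_diff algebra_simps)
  also have "\<dots> * compl_mean e n k q x = real m * ((\<Sum>i=1..n. x $ e i) / real n - q * ?L)"
    using q1 by (simp add: compl_mean_def)
  also have "real r * ?L + \<dots> = real m / real n * (\<Sum>i\<in>UNIV. x $ i)"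
    unfolding rq s by (simp add: algebra_simps)
  finally show "hyp_trace (mean_product e n k r m) 1 x = real m / real n * (\<Sum>i\<in>UNIV. x $ i)" .
qed

lemma garding_cone_esym_subset_mean_product:
  fixes e :: "nat \<Rightarrow> 'n::finite"
  assumes nk: "2 \<le> k" "k < n" and e: "bij_betw e {1..n} UNIV"
    and r: "0 < r" "r < m" and q: "real r / real m < real (n - k + 1) / real (2 * n - k)"
  shows "garding_cone (esym k :: real ^ 'n \<Rightarrow> real) 1 \<subseteq> garding_cone (mean_product e n k r m) 1"
proof
  fix x :: "real ^ 'n" assume x: "x \<in> garding_cone (esym k) 1"
  define q where "q = real r / real m"
  define N where "N = real (n - k + 1)"
  define D where "D = real (2 * n - k)"
  define A where "A = (\<Sum>i=1..n-k+1. x $ e i)"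
  define S where "S = (\<Sum>i=1..n. x $ e i)"
  have pos: "N > 0" "D > 0" "real n > 0" using nk by (auto simp: N_def D_def)
  have A: "A > 0" and AS: "real n * A \<le> D * S"
    using garding_cone_esym_sum_bounds[OF nk e x] by (simp_all only: A_def S_def D_def)
  \<comment> \<open>\<open>N / D\<close> is the upper bound on \<open>q\<close>; the resulting
    \<open>A / D\<close> is what the sum bounds compare with the full mean.\<close>
  have "q * (A / N) < N / D * (A / N)"
    using q A pos by (intro mult_strict_right_mono) (auto simp: q_def N_def D_def)
  also have "\<dots> = A / D" using pos by simp
  also have "\<dots> \<le> S / real n" using AS pos by (simp add: field_simps)
  finally have "S / real n - q * (A / N) > 0" by simp
  moreover have "q < 1" using r by (simp add: q_def)
  ultimately have "compl_mean e n k q x > 0"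
    unfolding compl_mean_def head_mean_def A_def[symmetric] S_def[symmetric] N_def[symmetric] by simp
  moreover have "head_mean e n k x > 0"
    unfolding head_mean_def A_def[symmetric] N_def[symmetric] using A pos by simp
  ultimately show "x \<in> garding_cone (mean_product e n k r m) 1"
    using garding_cone_mean_product[of n r m x e k] nk r by (simp add: q_def)
qed

section \<open>Failure of majorization near the boundary of the cone\<close>

text \<open>Raising both roots to the power \<open>k * m\<close> reduces the comparison to natural
  exponents.\<close>

lemma root_less_root_if_power:
  assumes "k > 0" "m > 0" "y \<ge> 0" "z \<ge> 0" "y ^ k < z ^ m"
  shows "root m y < root k z"
proof (rule ccontr)
  assume "\<not> root m y < root k z"
  then have "root k z ^ (k * m) \<le> root m y ^ (k * m)"
    using assms by (intro power_mono) auto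
  moreover have "root k z ^ (k * m) = z ^ m" using assms by (simp add: power_mult)
  moreover have "root m y ^ (k * m) = y ^ k"
    using assms by (simp add: mult.commute[of k] power_mult)
  ultimately show False using assms(5) by simp
qed

lemma head_eps_nth:
  assumes "bij_betw e {1..n} UNIV" "1 \<le> k" "i \<in> {1..n}"
  shows "head_eps e n k \<epsilon> $ e i = (if i \<le> n - k + 1 then \<epsilon> else 1)"
proof -
  have "e i \<in> e ` {1..n-k+1} \<longleftrightarrow> i \<in> {1..n-k+1}"
  proof (cases "n = 0")
    case False
    then have "{1..n-k+1} \<subseteq> {1..n}" using assms(2) by auto
    then show ?thesis
      using assms(1,3) by (intro inj_on_image_mem_iff[of e "{1..n}"]) (auto simp: bij_betw_def)
  qed (use assms in auto)
  then show ?thesis using assms(3) by (simp add: head_eps_def)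
qed

text \<open>All summands are nonnegative, and a single one suffices: one head coordinate times all
  \<open>k - 1\<close> tail coordinates equals \<epsilon>.\<close>

lemma esym_head_eps_ge:
  fixes e :: "nat \<Rightarrow> 'n::finite"
  assumes e: "bij_betw e {1..n} UNIV" and k: "1 \<le> k" "k \<le> n" and eps: "\<epsilon> > 0"
  shows "\<epsilon> \<le> esym k (head_eps e n k \<epsilon>)"
proof -
  let ?x = "head_eps e n k \<epsilon>"
  let ?I = "insert 1 {n-k+2..n}"
  have I: "?I \<subseteq> {1..n}" "1 \<notin> {n-k+2..n}" using k by auto
  have inj: "inj_on e ?I" using inj_on_subset[OF bij_betw_imp_inj_on[OF e] I(1)] .
  have card: "card (e ` ?I) = k"
    using card_image[OF inj] I(2) k by simp
  have "(\<Prod>i\<in>e ` ?I. ?x $ i) = (\<Prod>i\<in>?I. ?x $ e i)"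
    using prod.reindex[OF inj, of "\<lambda>i. ?x $ i"] by (simp add: o_def)
  also have "\<dots> = ?x $ e 1 * (\<Prod>i\<in>{n-k+2..n}. ?x $ e i)"
    using I(2) by simp
  also have "(\<Prod>i\<in>{n-k+2..n}. ?x $ e i) = 1"
    by (rule prod.neutral) (use k in \<open>auto simp: head_eps_nth[OF e k(1)]\<close>)
  also have "?x $ e 1 = \<epsilon>" using k by (simp add: head_eps_nth[OF e k(1)])
  finally have "\<epsilon> = (\<Prod>i\<in>e ` ?I. ?x $ i)" by simp
  also have "\<dots> \<le> esym k ?x"
    unfolding esym_def
  proof (rule member_le_sum)
    show "e ` ?I \<in> {S. S \<subseteq> UNIV \<and> card S = k}" using card by simp
    have "?x $ j \<ge> 0" for j using eps by (simp add: head_eps_def)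
    then show "0 \<le> (\<Prod>i\<in>S. ?x $ i)" for S by (intro prod_nonneg) simp
  qed simp
  finally show ?thesis .
qed

lemma head_eps_violates_majorization:
  fixes e :: "nat \<Rightarrow> 'n::finite"
  assumes nk: "2 \<le> k" "k < n" and e: "bij_betw e {1..n} UNIV"
    and r: "0 < r" "r < m"
    and q: "1 / real k < real r / real m" "real r / real m < real (n - k + 1) / real (2 * n - k)"
  shows "\<forall>\<^sub>F \<epsilon> in at_right 0.
    head_eps e n k \<epsilon> \<in> garding_cone (esym k) 1 \<and>
    root m (mean_product e n k r m (head_eps e n k \<epsilon>))
      < root m (mean_product e n k r m 1) * root k (esym k (head_eps e n k \<epsilon>) / real (n choose k))"
proof -
  define p where "p = real r / real m"
  have p1: "0 < p" "p < 1" using r by (simp_all add: p_def)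
  have n0: "n > 0" using nk by simp
  have card: "CARD('n) = n" using bij_betw_same_card[OF e] by simp
  define b where "b = real (n choose k)"
  have b: "b > 0" using nk by (simp add: b_def)
  \<comment> \<open>\<open>D\<close> bounds the factor of \<open>compl_mean\<close>, since the
    coordinates have mean at most 1.\<close>
  define D where "D = (1 / (1 - p)) ^ (m - r)"
  have D: "D > 0" using p1 by (simp add: D_def)
  have "real m < real (r * k)" using q(1) r nk by (simp add: field_simps)
  \<comment> \<open>This is \<open>q > 1/k\<close> in integers; it leaves at least one spare factor
    \<epsilon> in \<open>\<epsilon> ^ (r * k)\<close> against \<open>\<epsilon> ^ m\<close>.\<close>
  then have rk: "m < r * k" by (simp only: of_nat_less_iff)
  \<comment> \<open>The spare factor must absorb the constant \<open>D ^ k * b ^ m\<close>, and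
    \<open>\<epsilon> < 1\<close> makes its higher powers no larger.\<close>
  define \<delta> where "\<delta> = min 1 (1 / (D ^ k * b ^ m))"
  have \<delta>: "\<delta> > 0" using b D by (simp add: \<delta>_def)
  have one: "mean_product e n k r m 1 = 1"
    using p1 n0 by (simp add: mean_product_def head_mean_one compl_mean_one flip: p_def)
  show ?thesis
    unfolding eventually_at_right_field
  proof (intro exI[of _ \<delta>] conjI \<delta> allI impI)
    fix \<epsilon> :: real assume eps: "0 < \<epsilon>" "\<epsilon> < \<delta>"
    let ?x = "head_eps e n k \<epsilon>"
    have e1: "\<epsilon> < 1" "\<epsilon> * (D ^ k * b ^ m) < 1"
      using eps b D by (auto simp: \<delta>_def field_simps)
    show cone: "?x \<in> garding_cone (esym k) 1"
      using eps nk card by (intro positive_in_garding_cone_esym) (auto simp: head_eps_def)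
    have L: "compl_mean e n k p ?x > 0"
      using garding_cone_esym_subset_mean_product[OF nk e r q(2)] cone
        garding_cone_mean_product[OF n0 r] by (auto simp: p_def)
    have "n - k + 1 \<le> n" using nk by simp
    then have "(\<Sum>i=1..n-k+1. ?x $ e i) = (\<Sum>i=1..n-k+1. \<epsilon>)"
      using nk by (intro sum.cong) (auto simp: head_eps_nth[OF e])
    then have hm: "head_mean e n k ?x = \<epsilon>" by (simp add: head_mean_def)
    have "(\<Sum>i=1..n. ?x $ e i) \<le> (\<Sum>i=1..n. 1)"
      using e1 by (intro sum_mono) (auto simp: head_eps_def)
    then have "(\<Sum>i=1..n. ?x $ e i) / real n \<le> 1" using n0 by simp
    moreover have "p * \<epsilon> \<ge> 0" using p1 eps by simp
    ultimately have "compl_mean e n k p ?x \<le> 1 / (1 - p) * 1"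
      unfolding compl_mean_def hm using p1 by (intro mult_left_mono) auto
    then have Lm: "compl_mean e n k p ?x ^ (m - r) \<le> D"
      unfolding D_def using L by (intro power_mono) auto
    have "\<epsilon> ^ r * compl_mean e n k p ?x ^ (m - r) \<le> \<epsilon> ^ r * D"
      using Lm eps by (intro mult_left_mono) auto
    then have "root m (mean_product e n k r m ?x) \<le> root m (\<epsilon> ^ r * D)"
      using r by (simp add: mean_product_def hm p_def)
    also have "\<dots> < root k (\<epsilon> / b)"
    proof (rule root_less_root_if_power)
      have "\<epsilon> ^ (r * k - m) \<le> \<epsilon> ^ 1" using rk eps e1 by (intro power_decreasing) auto
      then have "\<epsilon> ^ (r * k - m) * (D ^ k * b ^ m) \<le> \<epsilon> * (D ^ k * b ^ m)"
        using b D by (intro mult_right_mono) auto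
      then have "\<epsilon> ^ m * (\<epsilon> ^ (r * k - m) * (D ^ k * b ^ m)) < \<epsilon> ^ m * 1"
        using e1 eps by (intro mult_strict_left_mono) auto
      moreover have "\<epsilon> ^ m * \<epsilon> ^ (r * k - m) = \<epsilon> ^ (r * k)"
        using rk by (simp add: power_add[symmetric])
      ultimately have "\<epsilon> ^ (r * k) * D ^ k * b ^ m < \<epsilon> ^ m" by (simp add: mult.assoc[symmetric])
      then show "(\<epsilon> ^ r * D) ^ k < (\<epsilon> / b) ^ m"
        using b by (simp add: power_mult_distrib power_divide power_mult[symmetric] pos_less_divide_eq)
    qed (use nk r eps D b in auto)
    also have "\<dots> \<le> root k (esym k ?x / b)"
      using esym_head_eps_ge[OF e, of k \<epsilon>] nk eps b by (simp add: divide_right_mono)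
    finally show "root m (mean_product e n k r m ?x)
        < root m (mean_product e n k r m 1) * root k (esym k ?x / real (n choose k))"
      using r by (simp add: one b_def)
  qed
qed

theorem mainTheorem4:
  fixes n k :: nat and e :: "nat \<Rightarrow> 'n::finite"
  assumes "3 \<le> k" and "k \<le> n - 1"
    and "bij_betw e {1..n} (UNIV :: 'n set)"
  shows "1 / real k < real (n - k + 1) / real (2 * n - k) \<and>
    (\<forall>r m :: nat. r > 0 \<and> m > 0 \<and>
       1 / real k < real r / real m \<and>
       real r / real m < real (n - k + 1) / real (2 * n - k) \<longrightarrow>
       one_central m (mean_product e n k r m) \<and>
       garding_cone (esym k :: real ^ 'n \<Rightarrow> real) 1 \<subseteq> garding_cone (mean_product e n k r m) 1 \<and>
       (\<forall>\<^sub>F \<epsilon> in at_right 0.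
          head_eps e n k \<epsilon> \<in> garding_cone (esym k) 1 \<and>
          root m (mean_product e n k r m (head_eps e n k \<epsilon>))
            < root m (mean_product e n k r m 1)
              * root k (esym k (head_eps e n k \<epsilon>) / real (n choose k))))"
proof (intro conjI allI impI)
  have nk: "2 \<le> k" "k < n" "n > 0" using assms by auto
  \<comment> \<open>With \<open>n = k + d\<close> the inequality clears to
    \<open>k + 2 d < k (d + 1)\<close>, that is \<open>2 d < k d\<close>, which is where
    \<open>k \<ge> 3\<close> enters.\<close>
  obtain d where d: "n = k + d" "d > 0" using nk(2) less_imp_add_positive by auto
  have "2 * d < k * d" using assms(1) d(2) by simp
  then have "real (2 * d) < real (k * d)" by (simp only: of_nat_less_iff)
  then have "real k + 2 * real d < real k * (real d + 1)" by (simp add: algebra_simps)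
  then show "1 / real k < real (n - k + 1) / real (2 * n - k)"
    using nk by (simp add: d(1) field_simps)
  fix r m :: nat
  assume rm: "r > 0 \<and> m > 0 \<and> 1 / real k < real r / real m \<and>
    real r / real m < real (n - k + 1) / real (2 * n - k)"
  \<comment> \<open>This gives \<open>q < 1\<close>, so \<open>m - r\<close> is positive and the
    factor \<open>1 / (1 - q)\<close> is meaningful.\<close>
  have "real (n - k + 1) / real (2 * n - k) < 1" using nk by simp
  then have "real r / real m < 1" using rm order.strict_trans by blast
  then have r: "0 < r" "r < m" using rm by simp_all
  show "one_central m (mean_product e n k r m)"
    by (rule one_central_mean_product) (use nk r assms(3) in auto)
  show "garding_cone (esym k :: real ^ 'n \<Rightarrow> real) 1 \<subseteq> garding_cone (mean_product e n k r m) 1"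
    by (rule garding_cone_esym_subset_mean_product) (use nk r rm assms(3) in auto)
  show "\<forall>\<^sub>F \<epsilon> in at_right 0.
      head_eps e n k \<epsilon> \<in> garding_cone (esym k) 1 \<and>
      root m (mean_product e n k r m (head_eps e n k \<epsilon>))
        < root m (mean_product e n k r m 1) * root k (esym k (head_eps e n k \<epsilon>) / real (n choose k))"
    by (rule head_eps_violates_majorization) (use nk r rm assms(3) in auto)
qed

end
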